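(* Let $m\ge 2$, let $0=t_0<t_1<\dots<t_m$ be the exercise dates, and let $S_t=S_0\exp(X_t)$ be the exponential Lévy model described in the context (zero interest rate, risk-neutral dynamics; $X$ a Lévy process with $X_0=0$ such that for every $t>0$ the support of $X_t$ is all of $\mathbb{R}$ and $X_t$ has a continuous density). Let $p>1$ and $p'>0$ be such that $S_t^{p}$ and $S_t^{-p'}$ are integrable for every $t\ge 0$. Assume the payoff functions grow at most linearly: there is $c>0$ with $|h_n(x)|\le c(1+x)$ for all $x\ge 0$ and $1\le n\le m$. Let $q$ be defined by $\frac1p+\frac1q=1$, put $$\nu=\min\left\{\frac{p'}{p'+q},\frac{p}{p+q}\right\},$$ and let the truncation intervals be $$I_n=[b_n^{-1},b_n],\quad 1\le n<m,\qquad\text{where}\qquad b_n=b_{n+1}^{\nu},\quad 1\le n<m-1 .$$ Then the truncated option price $V_0^{\mathrm{tr}}$ converges to the exact option price $V_0$ as $b_{m-1}\to\infty$.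
   Context: Model: $S_0>0$ is a constant, $X$ is a Lévy process with $X_0=0$, and $S_t=S_0e^{X_t}$. The interest rate is zero and the dynamics are risk neutral, i.e. $S$ is a martingale. The payoff from exercising the Bermudan option at date $t_n$ is $h_n(S_{t_n})$, where $h_0,\dots,h_m$ are given (Borel measurable) real functions on $[0,\infty)$. Conditional expectations given $S_{t_n}=x$, $x>0$, are understood via the Lévy structure: $\mathbf{E}[g(S_{t_{n+1}})\mid S_{t_n}=x]=\mathbf{E}[g(x\,S_{t_{n+1}}/S_{t_n})]$. Exact continuation values and price: $C_m(x)=0$, $$C_n(x)=\mathbf{E}[\max\{h_{n+1}(S_{t_{n+1}}),C_{n+1}(S_{t_{n+1}})\}\mid S_{t_n}=x],\quad 0\le n<m,$$ and $V_0=\max\{h_0(S_0),C_0(S_0)\}$. Truncated continuation values and price, for given finite intervals $I_1,\dots,I_{m-1}\subset\,]0,\infty[$: $C_m^{\mathrm{tr}}(x)=0$, $$C_n^{\mathrm{tr}}(x)=\mathbf{1}_{I_n}(x)\cdot\mathbf{E}[\max\{h_{n+1}(S_{t_{n+1}}),C^{\mathrm{tr}}_{n+1}(S_{t_{n+1}})\}\mid S_{t_n}=x],\quad 1\le n<m,$$ $$C_0^{\mathrm{tr}}(x)=\mathbf{E}[\max\{h_1(S_{t_1}),C_1^{\mathrm{tr}}(S_{t_1})\}\mid S_0=x],$$ and $V_0^{\mathrm{tr}}=\max\{h_0(S_0),C_0^{\mathrm{tr}}(S_0)\}$. *)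

theory Defs
  imports "HOL-Probability.Probability"
begin

section \<open>Levy processes and martingales\<close>

text \<open>
  Processes are indexed by \<^typ>\<open>real\<close>; only the values at times \<open>u \<ge> 0\<close> are relevant.
  Independence of increments is required for every finite sequence of times
  \<open>0 \<le> s 0 \<le> \<dots> \<le> s k\<close>; the value at the first time is included by taking \<open>s 0 = 0\<close>,
  since the process starts at 0.
\<close>

definition levy_process :: "'a measure \<Rightarrow> (real \<Rightarrow> 'a \<Rightarrow> real) \<Rightarrow> bool" where
  "levy_process M X \<longleftrightarrow>
     prob_space M \<and>
     (\<forall>u\<ge>0. X u \<in> borel_measurable M) \<and>
     (AE \<omega> in M. X 0 \<omega> = 0) \<and>
     (\<forall>(k::nat) (s::nat \<Rightarrow> real). 0 \<le> s 0 \<and> (\<forall>i<k. s i \<le> s (Suc i)) \<longrightarrow>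
        prob_space.indep_vars M (\<lambda>_. borel) (\<lambda>i \<omega>. X (s (Suc i)) \<omega> - X (s i) \<omega>) {..<k}) \<and>
     (\<forall>s\<ge>0. \<forall>u\<ge>0. distr M borel (\<lambda>\<omega>. X (s + u) \<omega> - X s \<omega>) = distr M borel (X u)) \<and>
     (\<forall>s\<ge>0. \<forall>\<epsilon>>0.
        ((\<lambda>u. measure M {\<omega> \<in> space M. \<epsilon> < \<bar>X u \<omega> - X s \<omega>\<bar>}) \<longlongrightarrow> 0) (at s within {0..})) \<and>
     (AE \<omega> in M.
        (\<forall>s\<ge>0. ((\<lambda>u. X u \<omega>) \<longlongrightarrow> X s \<omega>) (at_right s)) \<and>
        (\<forall>s>0. \<exists>l. ((\<lambda>u. X u \<omega>) \<longlongrightarrow> l) (at_left s)))"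

definition natural_filtration :: "'a measure \<Rightarrow> (real \<Rightarrow> 'a \<Rightarrow> real) \<Rightarrow> real \<Rightarrow> 'a measure" where
  "natural_filtration M Y u =
     sigma (space M) (\<Union>s\<in>{0..u}. {Y s -` A \<inter> space M | A. A \<in> sets borel})"

definition martingale ::
  "'a measure \<Rightarrow> (real \<Rightarrow> 'a measure) \<Rightarrow> (real \<Rightarrow> 'a \<Rightarrow> real) \<Rightarrow> bool" where
  "martingale M F Y \<longleftrightarrow>
     (\<forall>u\<ge>0. subalgebra M (F u)) \<and>
     (\<forall>s u. 0 \<le> s \<and> s \<le> u \<longrightarrow> sets (F s) \<subseteq> sets (F u)) \<and>
     (\<forall>u\<ge>0. Y u \<in> borel_measurable (F u) \<and> integrable M (Y u)) \<and>
     (\<forall>s u. 0 \<le> s \<and> s \<le> u \<longrightarrow> (AE \<omega> in M. real_cond_exp M (F s) (Y u) \<omega> = Y s \<omega>))"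

definition measure_support :: "'b::topological_space measure \<Rightarrow> 'b set" where
  "measure_support \<mu> = {x. \<forall>U. open U \<and> x \<in> U \<longrightarrow> 0 < emeasure \<mu> U}"


section \<open>Bermudan option prices\<close>

text \<open>
  The expectation of \<open>g (S v)\<close> given \<open>S u = x\<close>, where \<open>x > 0\<close>, understood through the
  independent ratio \<open>S v / S u\<close>.
\<close>

definition ratio_expectation ::
  "'a measure \<Rightarrow> (real \<Rightarrow> 'a \<Rightarrow> real) \<Rightarrow> real \<Rightarrow> real \<Rightarrow> (real \<Rightarrow> real) \<Rightarrow> real \<Rightarrow> real" where
  "ratio_expectation M S u v g x = (LINT \<omega>|M. g (x * (S v \<omega> / S u \<omega>)))"

context
  fixes M :: "'a measure" and S :: "real \<Rightarrow> 'a \<Rightarrow> real"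
    and t :: "nat \<Rightarrow> real" and h :: "nat \<Rightarrow> real \<Rightarrow> real" and m :: nat
begin

text \<open>The continuation values are set to 0 from the last exercise date \<open>m\<close> on.\<close>

function continuation :: "nat \<Rightarrow> real \<Rightarrow> real" where
  "continuation n = (if m \<le> n then (\<lambda>x. 0) else
     ratio_expectation M S (t n) (t (Suc n))
       (\<lambda>y. max (h (Suc n) y) (continuation (Suc n) y)))"
  by pat_completeness auto
termination by (relation "Wellfounded.measure (\<lambda>n. m - n)") auto

function truncated_continuation :: "(nat \<Rightarrow> real set) \<Rightarrow> nat \<Rightarrow> real \<Rightarrow> real" where
  "truncated_continuation I n = (if m \<le> n then (\<lambda>x. 0) else
     (\<lambda>x. (if n = 0 then 1 else indicator (I n) x) *
       ratio_expectation M S (t n) (t (Suc n))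
         (\<lambda>y. max (h (Suc n) y) (truncated_continuation I (Suc n) y)) x))"
  by pat_completeness auto
termination by (relation "Wellfounded.measure (\<lambda>(I, n). m - n)") auto

definition option_price :: "real \<Rightarrow> real" where
  "option_price s0 = max (h 0 s0) (continuation 0 s0)"

definition truncated_option_price :: "(nat \<Rightarrow> real set) \<Rightarrow> real \<Rightarrow> real" where
  "truncated_option_price I s0 = max (h 0 s0) (truncated_continuation I 0 s0)"

end

text \<open>The defining equations loop as rewrite rules.\<close>

declare continuation.simps [simp del] truncated_continuation.simps [simp del]

end

theory Submission
  imports Defs
begin

text \<open>
  Dominated convergence, applied once per exercise date, proves the theorem.  Backwards from
  the last date, every truncated continuation value is bounded by \<open>K * (1 + x)\<close> with
  a constant \<open>K\<close> that does not depend on the truncation sets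
  (\<open>linear_growth_truncated_continuation\<close>): one step replaces \<open>x\<close> by \<open>x * R\<close> for an integrable
  price ratio \<open>R\<close>, so linear growth passes through the conditional expectation, and multiplying by
  an indicator can only decrease the absolute value.  Hence, if the truncation sets eventually contain
  each positive \<open>x\<close>, the integrands of step \<open>n\<close> converge pointwise by the result for step
  \<open>n + 1\<close>, and they are dominated by a multiple of \<open>1 + x * R\<close>
  (\<open>tendsto_truncated_continuation\<close>).  The exact value is the truncated value for the
  sets \<open>UNIV\<close>, so both are treated at once.

  It remains to see that the ratios are integrable, which follows from stationary increments and
  the integrability of the price, and that all intervals exhaust the positive half-line.
  The latter holds because \<open>\<nu>\<close> is positive: each \<open>b \<beta> n\<close> is a fixed number of \<open>\<nu>\<close>-th powers away
  from \<open>\<beta>\<close>, hence tends to infinity with \<open>\<beta>\<close>.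
\<close>

section \<open>Functions of linear growth\<close>

text \<open>
  Prices are strictly positive, so measurability and the bound are only required there.  At 0 a
  continuation value depends on the payoff at 0, which never enters the price.
\<close>

definition linear_growth :: "real \<Rightarrow> (real \<Rightarrow> real) \<Rightarrow> bool" where
  "linear_growth K f \<longleftrightarrow>
     f \<in> borel_measurable (restrict_space borel {0<..}) \<and> (\<forall>x>0. \<bar>f x\<bar> \<le> K * (1 + x))"

lemma linear_growth_zero: "linear_growth 0 (\<lambda>x. 0)"
  by (simp add: linear_growth_def)

lemma linear_growth_max:
  assumes "linear_growth K f" "linear_growth L g"
  shows "linear_growth (K + L) (\<lambda>x. max (f x) (g x))"
proof -
  have "\<bar>max (f x) (g x)\<bar> \<le> (K + L) * (1 + x)" if "0 < x" for x
  proof -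
    have "\<bar>f x\<bar> \<le> K * (1 + x)" "\<bar>g x\<bar> \<le> L * (1 + x)"
      using assms that by (auto simp: linear_growth_def)
    moreover have "\<bar>max (f x) (g x)\<bar> \<le> \<bar>f x\<bar> + \<bar>g x\<bar>"
      by linarith
    ultimately show ?thesis
      by (simp add: distrib_right)
  qed
  moreover have "(\<lambda>x. max (f x) (g x)) \<in> borel_measurable (restrict_space borel {0<..})"
    using assms unfolding linear_growth_def by (blast intro: borel_measurable_max)
  ultimately show ?thesis
    by (simp add: linear_growth_def)
qed

lemma linear_growth_indicator_mult:
  assumes "linear_growth K f" "A \<in> sets borel"
  shows "linear_growth K (\<lambda>x. indicator A x * f x)"
proof -
  have "\<bar>indicator A x * f x\<bar> \<le> K * (1 + x)" if "0 < x" for x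
  proof -
    have "\<bar>indicator A x * f x\<bar> \<le> \<bar>f x\<bar>"
      by (simp add: indicator_def)
    also have "\<dots> \<le> K * (1 + x)"
      using assms(1) that by (auto simp: linear_growth_def)
    finally show ?thesis .
  qed
  moreover have "(indicator A :: real \<Rightarrow> real) \<in> borel_measurable (restrict_space borel {0<..})"
    using assms(2) by (intro measurable_restrict_space1) simp
  then have "(\<lambda>x. indicator A x * f x) \<in> borel_measurable (restrict_space borel {0<..})"
    using assms(1) unfolding linear_growth_def by (blast intro: borel_measurable_times)
  ultimately show ?thesis
    by (simp add: linear_growth_def)
qed

section \<open>One step of the recursion\<close>

context prob_space
begin

lemma measurable_comp_scaled_ratio:
  assumes "linear_growth K f" "R \<in> borel_measurable M" "\<And>\<omega>. \<omega> \<in> space M \<Longrightarrow> 0 < R \<omega>" "0 < x"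
  shows "(\<lambda>\<omega>. f (x * R \<omega>)) \<in> borel_measurable M"
proof -
  have "(\<lambda>\<omega>. x * R \<omega>) \<in> measurable M (restrict_space borel {0<..})"
    using assms by (intro measurable_restrict_space2) auto
  then show ?thesis
    using assms(1) unfolding linear_growth_def by (auto intro: measurable_compose)
qed

lemma linear_growth_expectation:
  assumes f: "linear_growth K f" and R: "integrable M R"
    and pos: "\<And>\<omega>. \<omega> \<in> space M \<Longrightarrow> 0 < R \<omega>"
  shows "linear_growth (K * (1 + expectation R)) (\<lambda>x. expectation (\<lambda>\<omega>. f (x * R \<omega>)))"
proof -
  let ?P = "restrict_space borel {0<..} :: real measure"
  have [measurable]: "R \<in> borel_measurable M"
    using R by auto
  have [measurable]: "(\<lambda>x. x) \<in> borel_measurable ?P"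
    by (intro measurable_restrict_space1) simp
  have "(\<lambda>(x, \<omega>). x * R \<omega>) \<in> measurable (?P \<Otimes>\<^sub>M M) ?P"
  proof (rule measurable_restrict_space2)
    show "(\<lambda>(x, \<omega>). x * R \<omega>) \<in> space (?P \<Otimes>\<^sub>M M) \<rightarrow> {0<..}"
      using pos by (auto simp: space_pair_measure space_restrict_space)
    have "fst \<in> borel_measurable (?P \<Otimes>\<^sub>M M)"
      by (rule measurable_compose[OF measurable_fst \<open>(\<lambda>x. x) \<in> borel_measurable ?P\<close>])
    then show "(\<lambda>(x, \<omega>). x * R \<omega>) \<in> borel_measurable (?P \<Otimes>\<^sub>M M)"
      by (simp add: case_prod_beta')
  qed
  moreover have "f \<in> borel_measurable ?P"
    using f by (simp add: linear_growth_def)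
  ultimately have "(\<lambda>z. f ((\<lambda>(x, \<omega>). x * R \<omega>) z)) \<in> borel_measurable (?P \<Otimes>\<^sub>M M)"
    by (rule measurable_compose)
  then have meas: "(\<lambda>x. expectation (\<lambda>\<omega>. f (x * R \<omega>))) \<in> borel_measurable ?P"
    by (intro borel_measurable_lebesgue_integral) (simp add: case_prod_beta')
  have "0 \<le> K"
  proof -
    have "0 \<le> K * (1 + 1)"
      using f by (meson linear_growth_def abs_ge_zero order_trans zero_less_one)
    then show ?thesis by simp
  qed
  have ER: "0 \<le> expectation R"
    using pos by (intro integral_nonneg_AE AE_I2) (simp add: less_imp_le)
  have "\<bar>expectation (\<lambda>\<omega>. f (x * R \<omega>))\<bar> \<le> K * (1 + expectation R) * (1 + x)" if "0 < x" for x
  proof -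
    have dom: "integrable M (\<lambda>\<omega>. K * (1 + x * R \<omega>))"
      using R by simp
    have "\<bar>expectation (\<lambda>\<omega>. f (x * R \<omega>))\<bar> \<le> expectation (\<lambda>\<omega>. \<bar>f (x * R \<omega>)\<bar>)"
      by (rule integral_abs_bound)
    also have "\<dots> \<le> expectation (\<lambda>\<omega>. K * (1 + x * R \<omega>))"
      using f pos that \<open>0 \<le> K\<close>
      by (intro integral_mono_AE' dom AE_I2) (auto simp: linear_growth_def less_imp_le)
    also have "\<dots> = K * (1 + x * expectation R)"
      using R by (simp add: prob_space)
    also have "\<dots> \<le> K * ((1 + expectation R) * (1 + x))"
      using \<open>0 \<le> K\<close> ER that by (intro mult_left_mono) (simp_all add: algebra_simps)
    finally show ?thesis
      by (simp add: mult.assoc)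
  qed
  with meas show ?thesis
    by (simp add: linear_growth_def)
qed

lemma tendsto_expectation_scaled_ratio:
  fixes G :: "real \<Rightarrow> real \<Rightarrow> real"
  assumes G: "\<And>\<beta>. linear_growth K (G \<beta>)" and g: "linear_growth K g"
    and R: "integrable M R" and pos: "\<And>\<omega>. \<omega> \<in> space M \<Longrightarrow> 0 < R \<omega>"
    and lim: "\<And>y. 0 < y \<Longrightarrow> ((\<lambda>\<beta>. G \<beta> y) \<longlongrightarrow> g y) at_top"
    and "0 < x"
  shows "((\<lambda>\<beta>. expectation (\<lambda>\<omega>. G \<beta> (x * R \<omega>))) \<longlongrightarrow> expectation (\<lambda>\<omega>. g (x * R \<omega>))) at_top"
proof (rule integral_dominated_convergence_at_top)
  show "integrable M (\<lambda>\<omega>. K * (1 + x * R \<omega>))"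
    using R by simp
  show "(\<lambda>\<omega>. g (x * R \<omega>)) \<in> borel_measurable M"
    using R pos by (intro measurable_comp_scaled_ratio[OF g _ _ \<open>0 < x\<close>]) auto
  show "(\<lambda>\<omega>. G \<beta> (x * R \<omega>)) \<in> borel_measurable M" for \<beta>
    using R pos by (intro measurable_comp_scaled_ratio[OF G _ _ \<open>0 < x\<close>]) auto
  show "\<forall>\<^sub>F \<beta> in at_top. AE \<omega> in M. norm (G \<beta> (x * R \<omega>)) \<le> K * (1 + x * R \<omega>)"
    using G pos \<open>0 < x\<close> by (intro always_eventually allI AE_I2) (auto simp: linear_growth_def)
  show "AE \<omega> in M. ((\<lambda>\<beta>. G \<beta> (x * R \<omega>)) \<longlongrightarrow> g (x * R \<omega>)) at_top"
    using lim pos \<open>0 < x\<close> by (intro AE_I2) simp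
qed

end

section \<open>Truncated continuation values\<close>

lemma continuation_eq_truncated_UNIV:
  "continuation M S t h m n = truncated_continuation M S t h m (\<lambda>_. UNIV) n"
proof (induction "m - n" arbitrary: n rule: less_induct)
  case less
  have "continuation M S t h m (Suc n) = truncated_continuation M S t h m (\<lambda>_. UNIV) (Suc n)"
    if "n < m"
    using that by (intro less) simp
  then show ?case
    by (subst continuation.simps, subst truncated_continuation.simps) (auto simp: fun_eq_iff)
qed

text \<open>
  Conditional expectations average over the price ratio of one period, so the assumptions on
  the market are assumptions on these ratios.
\<close>

locale bermudan_option = prob_space M
  for M :: "'a measure" +
  fixes S :: "real \<Rightarrow> 'a \<Rightarrow> real" and t :: "nat \<Rightarrow> real"
    and h :: "nat \<Rightarrow> real \<Rightarrow> real" and m :: nat and c :: real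
  assumes ratio_pos: "\<And>n \<omega>. n < m \<Longrightarrow> \<omega> \<in> space M \<Longrightarrow> 0 < S (t (Suc n)) \<omega> / S (t n) \<omega>"
    and integrable_ratio: "\<And>n. n < m \<Longrightarrow> integrable M (\<lambda>\<omega>. S (t (Suc n)) \<omega> / S (t n) \<omega>)"
    and linear_growth_payoff: "\<And>n. 1 \<le> n \<Longrightarrow> n \<le> m \<Longrightarrow> linear_growth c (h n)"
begin

abbreviation trunc :: "(nat \<Rightarrow> real set) \<Rightarrow> nat \<Rightarrow> real \<Rightarrow> real" where
  "trunc \<equiv> truncated_continuation M S t h m"

text \<open>
  The order of the quantifiers is the point: one constant serves all truncation sets, which
  is what a dominating function for varying sets requires.
\<close>

lemma linear_growth_truncated_continuation:
  assumes "n \<le> m"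
  shows "\<exists>K. \<forall>I. (\<forall>k. I k \<in> sets borel) \<longrightarrow> linear_growth K (trunc I n)"
  using assms
proof (induction n rule: inc_induct)
  case base
  then show ?case
    using linear_growth_zero by (auto simp: truncated_continuation.simps[of _ _ _ _ _ _ m])
next
  case (step n)
  from step.IH obtain K where
    K: "\<And>I. \<forall>k. I k \<in> sets borel \<Longrightarrow> linear_growth K (trunc I (Suc n))"
    by blast
  let ?R = "\<lambda>\<omega>. S (t (Suc n)) \<omega> / S (t n) \<omega>"
  have "linear_growth ((c + K) * (1 + expectation ?R)) (trunc I n)"
    if I: "\<forall>k. I k \<in> sets borel" for I
  proof -
    have "linear_growth (c + K) (\<lambda>y. max (h (Suc n) y) (trunc I (Suc n) y))"
      using linear_growth_payoff[of "Suc n"] K[OF I] step.hyps by (intro linear_growth_max) auto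
    then have E: "linear_growth ((c + K) * (1 + expectation ?R))
        (ratio_expectation M S (t n) (t (Suc n)) (\<lambda>y. max (h (Suc n) y) (trunc I (Suc n) y)))"
      using linear_growth_expectation[OF _ integrable_ratio ratio_pos] step.hyps
      by (simp add: ratio_expectation_def[abs_def])
    show ?thesis
    proof (cases "n = 0")
      case True
      with E step.hyps show ?thesis
        by (subst truncated_continuation.simps) simp
    next
      case False
      with E step.hyps I show ?thesis
        by (subst truncated_continuation.simps) (simp add: linear_growth_indicator_mult)
    qed
  qed
  then show ?case
    by blast
qed

lemma tendsto_truncated_continuation:
  fixes I :: "real \<Rightarrow> nat \<Rightarrow> real set"
  assumes borel: "\<And>\<beta> k. I \<beta> k \<in> sets borel"
    and exhaust: "\<And>k x. 1 \<le> k \<Longrightarrow> k < m \<Longrightarrow> 0 < x \<Longrightarrow> \<forall>\<^sub>F \<beta> in at_top. x \<in> I \<beta> k"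
    and "n \<le> m" "0 < x"
  shows "((\<lambda>\<beta>. trunc (I \<beta>) n x) \<longlongrightarrow> continuation M S t h m n x) at_top"
  using \<open>n \<le> m\<close> \<open>0 < x\<close>
proof (induction n arbitrary: x rule: inc_induct)
  case base
  then show ?case
    by (simp add: truncated_continuation.simps[of _ _ _ _ _ _ m] continuation.simps[of _ _ _ _ _ m])
next
  case (step n)
  obtain K where
    K: "\<And>I. \<forall>k. I k \<in> sets borel \<Longrightarrow> linear_growth K (trunc I (Suc n))"
    using linear_growth_truncated_continuation[of "Suc n"] step.hyps by auto
  let ?G = "\<lambda>\<beta> y. max (h (Suc n) y) (trunc (I \<beta>) (Suc n) y)"
  let ?g = "\<lambda>y. max (h (Suc n) y) (continuation M S t h m (Suc n) y)"
  let ?R = "\<lambda>\<omega>. S (t (Suc n)) \<omega> / S (t n) \<omega>"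
  have h: "linear_growth c (h (Suc n))"
    using linear_growth_payoff[of "Suc n"] step.hyps by simp
  have "((\<lambda>\<beta>. expectation (\<lambda>\<omega>. ?G \<beta> (x * ?R \<omega>))) \<longlongrightarrow> expectation (\<lambda>\<omega>. ?g (x * ?R \<omega>))) at_top"
  proof (rule tendsto_expectation_scaled_ratio)
    show "linear_growth (c + K) (?G \<beta>)" for \<beta>
      using h K borel by (simp add: linear_growth_max)
    show "linear_growth (c + K) ?g"
      using h K by (simp add: linear_growth_max continuation_eq_truncated_UNIV)
    show "integrable M ?R" "\<And>\<omega>. \<omega> \<in> space M \<Longrightarrow> 0 < ?R \<omega>"
      using integrable_ratio ratio_pos step.hyps by auto
    show "((\<lambda>\<beta>. ?G \<beta> y) \<longlongrightarrow> ?g y) at_top" if "0 < y" for y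
      using step.IH[OF that] by (intro tendsto_max tendsto_const)
    show "0 < x" by fact
  qed
  then have lim: "((\<lambda>\<beta>. ratio_expectation M S (t n) (t (Suc n)) (?G \<beta>) x)
      \<longlongrightarrow> continuation M S t h m n x) at_top"
    using step.hyps by (simp add: ratio_expectation_def continuation.simps[of _ _ _ _ _ n])
  have "\<forall>\<^sub>F \<beta> in at_top. n = 0 \<or> x \<in> I \<beta> n"
    using exhaust[of n x] step.hyps step.prems by (cases "n = 0") auto
  then have "\<forall>\<^sub>F \<beta> in at_top.
      ratio_expectation M S (t n) (t (Suc n)) (?G \<beta>) x = trunc (I \<beta>) n x"
    by eventually_elim
      (use step.hyps in \<open>auto simp: truncated_continuation.simps[of _ _ _ _ _ _ n]\<close>)
  with lim show ?case
    by (rule Lim_transform_eventually)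
qed

end

section \<open>The truncation intervals exhaust the positive half-line\<close>

lemma eventually_mem_inverse_interval:
  fixes f :: "'b \<Rightarrow> real"
  assumes "filterlim f at_top F" "0 < x"
  shows "\<forall>\<^sub>F \<beta> in F. x \<in> {inverse (f \<beta>)..f \<beta>}"
proof -
  have "\<forall>\<^sub>F \<beta> in F. max x (inverse x) \<le> f \<beta>"
    using assms(1) unfolding filterlim_at_top by blast
  then show ?thesis
  proof eventually_elim
    case (elim \<beta>)
    then have "inverse (f \<beta>) \<le> inverse (inverse x)"
      using \<open>0 < x\<close> by (intro le_imp_inverse_le) auto
    with elim show ?case by simp
  qed
qed

lemma filterlim_iterated_powr_at_top:
  fixes b :: "real \<Rightarrow> nat \<Rightarrow> real"
  assumes "0 < \<nu>" and last: "\<And>\<beta>. 1 \<le> \<beta> \<Longrightarrow> b \<beta> N = \<beta>"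
    and rec: "\<And>\<beta> n. 1 \<le> \<beta> \<Longrightarrow> 1 \<le> n \<Longrightarrow> n < N \<Longrightarrow> b \<beta> n = b \<beta> (Suc n) powr \<nu>"
    and "1 \<le> n" "n \<le> N"
  shows "filterlim (\<lambda>\<beta>. b \<beta> n) at_top at_top"
  using \<open>n \<le> N\<close> \<open>1 \<le> n\<close>
proof (induction n rule: inc_induct)
  case base
  have "\<forall>\<^sub>F \<beta> in at_top. b \<beta> N = \<beta>"
    using eventually_ge_at_top[of 1] by eventually_elim (rule last)
  then show ?case
    using filterlim_cong[OF refl refl] filterlim_ident by fast
next
  case (step n)
  then have "filterlim (\<lambda>\<beta>. b \<beta> (Suc n) powr \<nu>) at_top at_top"
    using filterlim_compose[OF real_powr_at_top[OF \<open>0 < \<nu>\<close>]] by simp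
  moreover have "\<forall>\<^sub>F \<beta> in at_top. b \<beta> n = b \<beta> (Suc n) powr \<nu>"
    using eventually_ge_at_top[of 1]
    by eventually_elim (rule rec, use step in auto)
  ultimately show ?case
    using filterlim_cong[OF refl refl] by fast
qed

lemma truncation_exponent_pos:
  fixes p p' q \<nu> :: real
  assumes "1 < p" "0 < p'" "1 / p + 1 / q = 1" "\<nu> = min (p' / (p' + q)) (p / (p + q))"
  shows "0 < \<nu>"
proof -
  have "1 / p < 1" using \<open>1 < p\<close> by simp
  then have "0 < 1 / q" using \<open>1 / p + 1 / q = 1\<close> by linarith
  then have "0 < q" by simp
  then show ?thesis using assms by simp
qed

section \<open>Price ratios of an exponential Levy process\<close>

text \<open>
  By stationarity of the increments, \<open>exp (X v - X u)\<close> has the law of \<open>exp (X (v - u))\<close>.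
\<close>

lemma levy_process_integrable_exp_increment:
  assumes "levy_process M X" "0 \<le> u" "u \<le> v"
    and "integrable M (\<lambda>\<omega>. exp (X (v - u) \<omega>))"
  shows "integrable M (\<lambda>\<omega>. exp (X v \<omega> - X u \<omega>))"
proof -
  have [measurable]: "X w \<in> borel_measurable M" if "0 \<le> w" for w
    using assms(1) that by (simp add: levy_process_def)
  have "distr M borel (\<lambda>\<omega>. X (u + (v - u)) \<omega> - X u \<omega>) = distr M borel (X (v - u))"
    using assms(1-3) unfolding levy_process_def by (meson diff_ge_0_iff_ge)
  then have "distr M borel (\<lambda>\<omega>. X v \<omega> - X u \<omega>) = distr M borel (X (v - u))"
    by simp
  moreover have "integrable (distr M borel (X (v - u))) exp"
    using assms by (subst integrable_distr_eq) auto
  ultimately have "integrable (distr M borel (\<lambda>\<omega>. X v \<omega> - X u \<omega>)) exp"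
    by simp
  then show ?thesis
    using assms(2,3) by (subst (asm) integrable_distr_eq) auto
qed

lemma martingale_integrable: "martingale M F Y \<Longrightarrow> 0 \<le> u \<Longrightarrow> integrable M (Y u)"
  by (simp add: martingale_def)

lemma bermudan_option_exponential_levy:
  assumes levy: "levy_process M X" and "0 < S0"
    and int: "\<And>u. 0 \<le> u \<Longrightarrow> integrable M (\<lambda>\<omega>. S0 * exp (X u \<omega>))"
    and "t 0 = 0" and mono: "\<And>n. n < m \<Longrightarrow> t n < t (Suc n)"
    and meas: "\<And>n. n \<le> m \<Longrightarrow> h n \<in> borel_measurable (restrict_space borel {0..})"
    and bound: "\<And>n x. 1 \<le> n \<Longrightarrow> n \<le> m \<Longrightarrow> 0 \<le> x \<Longrightarrow> \<bar>h n x\<bar> \<le> c * (1 + x)"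
  shows "bermudan_option M (\<lambda>u \<omega>. S0 * exp (X u \<omega>)) t h m c"
proof -
  have ratio: "S0 * exp (X v \<omega>) / (S0 * exp (X u \<omega>)) = exp (X v \<omega> - X u \<omega>)" for u v \<omega>
    using \<open>0 < S0\<close> by (simp add: exp_diff)
  have t_nonneg: "0 \<le> t n" if "n \<le> m" for n
    using that
  proof (induction n)
    case 0
    then show ?case using \<open>t 0 = 0\<close> by simp
  next
    case (Suc n)
    then show ?case using mono[of n] by simp
  qed
  have exp_int: "integrable M (\<lambda>\<omega>. exp (X u \<omega>))" if "0 \<le> u" for u
    using int[OF that] \<open>0 < S0\<close> by simp
  show ?thesis
  proof (intro bermudan_option.intro bermudan_option_axioms.intro)
    show "prob_space M"
      using levy by (simp add: levy_process_def)
    show "0 < S0 * exp (X (t (Suc n)) \<omega>) / (S0 * exp (X (t n) \<omega>))" for n \<omega>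
      using \<open>0 < S0\<close> by simp
    show "integrable M (\<lambda>\<omega>. S0 * exp (X (t (Suc n)) \<omega>) / (S0 * exp (X (t n) \<omega>)))"
      if "n < m" for n
      unfolding ratio using t_nonneg[of n] mono[OF that] that
      by (intro levy_process_integrable_exp_increment levy exp_int) auto
    show "linear_growth c (h n)" if "1 \<le> n" "n \<le> m" for n
    proof -
      have "h n \<in> borel_measurable (restrict_space borel {0<..})"
        using meas[OF \<open>n \<le> m\<close>] by (rule measurable_restrict_mono) auto
      then show ?thesis
        using bound[OF that] by (simp add: linear_growth_def)
    qed
  qed
qed

section \<open>Convergence of the truncated price\<close>

lemma (in bermudan_option) tendsto_truncated_option_price:
  fixes b :: "real \<Rightarrow> nat \<Rightarrow> real"
  assumes "0 < \<nu>" "\<And>\<beta>. 1 \<le> \<beta> \<Longrightarrow> b \<beta> (m - 1) = \<beta>"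
    and "\<And>\<beta> n. 1 \<le> \<beta> \<Longrightarrow> 1 \<le> n \<Longrightarrow> n < m - 1 \<Longrightarrow> b \<beta> n = b \<beta> (Suc n) powr \<nu>"
    and "0 < s"
  shows "((\<lambda>\<beta>. truncated_option_price M S t h m (\<lambda>n. {inverse (b \<beta> n)..b \<beta> n}) s)
           \<longlongrightarrow> option_price M S t h m s) at_top"
proof -
  have b_top: "filterlim (\<lambda>\<beta>. b \<beta> n) at_top at_top" if "1 \<le> n" "n < m" for n
    by (rule filterlim_iterated_powr_at_top[where N = "m - 1", OF assms(1-3)])
      (use that in auto)
  have "((\<lambda>\<beta>. trunc (\<lambda>n. {inverse (b \<beta> n)..b \<beta> n}) 0 s) \<longlongrightarrow> continuation M S t h m 0 s) at_top"
  proof (rule tendsto_truncated_continuation)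
    show "\<forall>\<^sub>F \<beta> in at_top. x \<in> {inverse (b \<beta> k)..b \<beta> k}" if "1 \<le> k" "k < m" "0 < x" for k x
      using eventually_mem_inverse_interval[OF b_top[OF that(1,2)] that(3)] .
  qed (use \<open>0 < s\<close> in auto)
  then show ?thesis
    unfolding truncated_option_price_def option_price_def
    by (intro tendsto_max tendsto_const)
qed

theorem theorem2:
  fixes M :: "'a measure"
    and X S :: "real \<Rightarrow> 'a \<Rightarrow> real"
    and S0 p p' q c \<nu> :: real
    and m :: nat
    and t :: "nat \<Rightarrow> real"
    and h :: "nat \<Rightarrow> real \<Rightarrow> real"
    and b :: "real \<Rightarrow> nat \<Rightarrow> real"
  assumes "2 \<le> m"
    and "t 0 = 0" and "\<And>n. n < m \<Longrightarrow> t n < t (Suc n)"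
    and "levy_process M X"
    and "\<And>u. 0 < u \<Longrightarrow> measure_support (distr M borel (X u)) = UNIV"
    and "\<And>u. 0 < u \<Longrightarrow>
           \<exists>f :: real \<Rightarrow> real. continuous_on UNIV f \<and> (\<forall>x. 0 \<le> f x) \<and>
             distributed M lborel (X u) (\<lambda>x. ennreal (f x))"
    and "0 < S0" and "S = (\<lambda>u \<omega>. S0 * exp (X u \<omega>))"
    and "martingale M (natural_filtration M S) S"
    and "1 < p" and "0 < p'"
    and "\<And>u. 0 \<le> u \<Longrightarrow> integrable M (\<lambda>\<omega>. S u \<omega> powr p)"
    and "\<And>u. 0 \<le> u \<Longrightarrow> integrable M (\<lambda>\<omega>. S u \<omega> powr (- p'))"
    and "\<And>n. n \<le> m \<Longrightarrow> h n \<in> borel_measurable (restrict_space borel {0..})"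
    and "0 < c"
    and "\<And>n x. 1 \<le> n \<Longrightarrow> n \<le> m \<Longrightarrow> 0 \<le> x \<Longrightarrow> \<bar>h n x\<bar> \<le> c * (1 + x)"
    and "1 / p + 1 / q = 1"
    and "\<nu> = min (p' / (p' + q)) (p / (p + q))"
    and "\<And>\<beta>. 1 \<le> \<beta> \<Longrightarrow> b \<beta> (m - 1) = \<beta>"
    and "\<And>\<beta> n. 1 \<le> \<beta> \<Longrightarrow> 1 \<le> n \<Longrightarrow> n < m - 1 \<Longrightarrow> b \<beta> n = b \<beta> (Suc n) powr \<nu>"
  shows "((\<lambda>\<beta>. truncated_option_price M S t h m (\<lambda>n. {inverse (b \<beta> n)..b \<beta> n}) S0)
           \<longlongrightarrow> option_price M S t h m S0) at_top"
  using martingale_integrable[OF assms(9)] unfolding assms(8)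
  by (intro bermudan_option.tendsto_truncated_option_price
        [OF bermudan_option_exponential_levy[OF assms(4,7) _ assms(2,3,14,16)]
          truncation_exponent_pos[OF assms(10,11,17,18)] assms(19,20,7)])

end
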